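(* Let $k\geq 2$ be fixed and let $P_k=\{u\in F_k \mid w(u)>0\}$ be the subset of the free group $F_k$ defined in the context. There is an algorithm which, given a reduced word $u$ over $\Sigma_k^{\pm}$ as input, decides whether $u\in P_k$ in time linear in the length of $u$.
   Context: Let $\Sigma_k=\{s_1,\dots,s_k\}$, let $F_k=F(\Sigma_k)$ be the free group on $\Sigma_k$, write $S_i=s_i^{-1}$, and let $\Sigma_k^{\pm}=\{s_1,\dots,s_k,S_1,\dots,S_k\}$. Elements of $F_k$ are identified with reduced words over $\Sigma_k^{\pm}$ (words with no two adjacent letters inverse to each other). For a reduced word $u$ define $$w(u)=\#\{\text{subwords of } u \text{ of the form } s_jS_i \text{ with } j>i\}-\#\{\text{subwords of } u \text{ of the form } S_js_i \text{ with } j>i\}+\tfrac12\,\epsilon(u),$$ where $\epsilon(u)=1$ if the last (rightmost) letter of $u$ is some $s_i$, $\epsilon(u)=-1$ if the last letter is some $S_i$, and $\epsilon(u)=0$ if $u$ is the empty word. A subword of length 2 is a pair of consecutive letters, and the numbers of subwords count occurrences. The set $P_k$ is the positive cone of a left order on $F_k$ (a total order invariant under left multiplication), given by $u>v \iff w(v^{-1}u)>0$. *)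

theory Defs
  imports Complex_Main "HOL-Library.Landau_Symbols"
begin

section \<open>Reduced words and the set of positive elements\<close>

datatype letter = Gen nat | Inv nat

fun letter_inv :: "letter \<Rightarrow> letter" where
  "letter_inv (Gen i) = Inv i"
| "letter_inv (Inv i) = Gen i"

definition letters :: "nat \<Rightarrow> letter set" where
  "letters k = Gen ` {1..k} \<union> Inv ` {1..k}"

definition reduced :: "letter list \<Rightarrow> bool" where
  "reduced u \<longleftrightarrow> successively (\<lambda>x y. y \<noteq> letter_inv x) u"

text \<open>Elements of the free group of rank \<open>k\<close> are identified with reduced words.\<close>

definition free_group :: "nat \<Rightarrow> letter list set" where
  "free_group k = {u. set u \<subseteq> letters k \<and> reduced u}"

definition pos_neg_count :: "letter list \<Rightarrow> nat" where
  "pos_neg_count u =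
     card {n. Suc n < length u \<and> (\<exists>i j. j > i \<and> u ! n = Gen j \<and> u ! Suc n = Inv i)}"

definition neg_pos_count :: "letter list \<Rightarrow> nat" where
  "neg_pos_count u =
     card {n. Suc n < length u \<and> (\<exists>i j. j > i \<and> u ! n = Inv j \<and> u ! Suc n = Gen i)}"

definition last_sign :: "letter list \<Rightarrow> int" where
  "last_sign u =
     (if u = [] then 0 else case last u of Gen _ \<Rightarrow> 1 | Inv _ \<Rightarrow> - 1)"

definition weight :: "letter list \<Rightarrow> rat" where
  "weight u = of_nat (pos_neg_count u) - of_nat (neg_pos_count u) + 1 / 2 * of_int (last_sign u)"

definition pos_cone :: "nat \<Rightarrow> letter list set" where
  "pos_cone k = {u \<in> free_group k. weight u > 0}"


section \<open>Deterministic multi-tape Turing machines\<close>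

text \<open>
  Tapes are infinite in both directions. States and auxiliary tape symbols are natural numbers;
  the predicate \<open>multitape_TM\<close> below requires that only finitely many of each are used.
\<close>

datatype 'a symbol = Blank | Letter 'a | Aux nat

datatype move = MoveLeft | Stay | MoveRight

fun offset :: "move \<Rightarrow> int" where
  "offset MoveLeft = - 1"
| "offset Stay = 0"
| "offset MoveRight = 1"

record 'a machine =
  tapes :: nat
  states :: "nat set"
  alphabet :: "'a symbol set"
  start_state :: nat
  accept_state :: nat
  reject_state :: nat
  transition :: "nat \<Rightarrow> 'a symbol list \<Rightarrow> nat \<times> ('a symbol \<times> move) list"

definition multitape_TM :: "'a set \<Rightarrow> 'a machine \<Rightarrow> bool" where
  "multitape_TM \<Sigma> M \<longleftrightarrow>
     tapes M \<ge> 1 \<and>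
     finite (states M) \<and>
     finite (alphabet M) \<and>
     insert Blank (Letter ` \<Sigma>) \<subseteq> alphabet M \<and>
     {start_state M, accept_state M, reject_state M} \<subseteq> states M \<and>
     accept_state M \<noteq> reject_state M \<and>
     (\<forall>q \<in> states M. \<forall>ss. length ss = tapes M \<and> set ss \<subseteq> alphabet M \<longrightarrow>
        (case transition M q ss of (q', acts) \<Rightarrow>
           q' \<in> states M \<and> length acts = tapes M \<and> fst ` set acts \<subseteq> alphabet M))"

text \<open>A tape is its content together with the position of the head.\<close>

type_synonym 'a tape = "(int \<Rightarrow> 'a symbol) \<times> int"
type_synonym 'a config = "nat \<times> 'a tape list"

fun read_tape :: "'a tape \<Rightarrow> 'a symbol" where
  "read_tape (c, h) = c h"

fun act_tape :: "'a symbol \<times> move \<Rightarrow> 'a tape \<Rightarrow> 'a tape" where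
  "act_tape (s, m) (c, h) = (c(h := s), h + offset m)"

fun step :: "'a machine \<Rightarrow> 'a config \<Rightarrow> 'a config" where
  "step M (q, ts) =
     (if q = accept_state M \<or> q = reject_state M then (q, ts)
      else case transition M q (map read_tape ts) of
        (q', acts) \<Rightarrow> (q', map2 act_tape acts ts))"

definition blank_tape :: "'a tape" where
  "blank_tape = (\<lambda>_. Blank, 0)"

definition input_tape :: "'a list \<Rightarrow> 'a tape" where
  "input_tape u =
     (\<lambda>p. if 0 \<le> p \<and> p < int (length u) then Letter (u ! nat p) else Blank, 0)"

definition initial_config :: "'a machine \<Rightarrow> 'a list \<Rightarrow> 'a config" where
  "initial_config M u =
     (start_state M, input_tape u # replicate (tapes M - 1) blank_tape)"

text \<open>
  On every input \<open>u\<close> from \<open>D\<close>, the machine halts after at most \<open>T |u|\<close> steps, accepting \<open>u\<close> if it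
  lies in \<open>L\<close> and rejecting it otherwise; nothing is required of inputs outside \<open>D\<close>. Since
  \<open>step\<close> leaves halted configurations unchanged, the state reached after \<open>t\<close> steps is the verdict.
\<close>

definition decides_in_time ::
  "'a machine \<Rightarrow> 'a list set \<Rightarrow> 'a list set \<Rightarrow> (nat \<Rightarrow> nat) \<Rightarrow> bool" where
  "decides_in_time M D L T \<longleftrightarrow>
     (\<forall>u \<in> D. \<exists>t \<le> T (length u).
        fst ((step M ^^ t) (initial_config M u)) =
          (if u \<in> L then accept_state M else reject_state M))"

end

theory Submission
  imports Defs "HOL-Library.Countable"
begin

text \<open>
  The weight can be computed by a single left-to-right scan: appending a letter \<open>y\<close> to \<open>u\<close> changes
  the integer part of the weight by an amount in \<open>{- 1, 0, 1}\<close> that depends only on \<open>y\<close> and the last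
  letter of \<open>u\<close> (\<open>balance_snoc\<close>). The last letter ranges over a finite set and fits into the state.
  The integer part itself is unbounded, but it need not be written in any numeral system: it is
  stored as the head position on a second tape, so that each update is one head move. Only its sign
  is needed in the end. To recover it, the origin of the second tape carries a mark, and the state
  remembers on which side of the mark the head last left it; unit moves cannot jump over the mark,
  so this bit gives the sign whenever the head is off the mark.

  The integer part and the final letter decide positivity (\<open>weight_pos_iff\<close>): the last summand
  of the weight is at most \<open>1/2\<close> in absolute value, so it matters only if the integer part vanishes. Besides reading each letter
  once, the machine spends one step on placing the mark and one step on the verdict, so it stops
  after \<open>n + 2\<close> steps.
\<close>

lemma card_adjacent_snoc:
  "card {n. Suc n < length (u @ [y]) \<and> P ((u @ [y]) ! n) ((u @ [y]) ! Suc n)} =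
   card {n. Suc n < length u \<and> P (u ! n) (u ! Suc n)} + of_bool (u \<noteq> [] \<and> P (last u) y)"
proof -
  let ?A = "{n. Suc n < length u \<and> P (u ! n) (u ! Suc n)}"
  let ?B = "{n. u \<noteq> [] \<and> n = length u - 1 \<and> P (last u) y}"
  have "{n. Suc n < length (u @ [y]) \<and> P ((u @ [y]) ! n) ((u @ [y]) ! Suc n)} = ?A \<union> ?B"
  proof (intro set_eqI)
    fix n
    consider "Suc n < length u" | "Suc n = length u" | "Suc n > length u" by linarith
    then show "n \<in> {n. Suc n < length (u @ [y]) \<and> P ((u @ [y]) ! n) ((u @ [y]) ! Suc n)}
      \<longleftrightarrow> n \<in> ?A \<union> ?B"
    proof cases
      case 2
      then have "u \<noteq> []" "n = length u - 1" by auto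
      with 2 show ?thesis by (simp add: nth_append last_conv_nth)
    qed (auto simp: nth_append)
  qed
  moreover have "finite ?A" by (rule finite_subset[of _ "{..<length u}"]) auto
  moreover have "finite ?B" by simp
  moreover have "?A \<inter> ?B = {}" by auto
  moreover have "card ?B = of_bool (u \<noteq> [] \<and> P (last u) y)" by auto
  ultimately show ?thesis by (simp add: card_Un_disjoint)
qed

fun turn :: "letter \<Rightarrow> letter \<Rightarrow> int" where
  "turn (Gen j) (Inv i) = of_bool (i < j)"
| "turn (Inv j) (Gen i) = - of_bool (i < j)"
| "turn _ _ = 0"

definition balance :: "letter list \<Rightarrow> int" where
  "balance u = int (pos_neg_count u) - int (neg_pos_count u)"

text \<open>
  \<open>Inv 0\<close> stands for the last letter of the empty word. No index is smaller than \<open>0\<close>, so it forms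
  no counted pair with its successor, and being an inverse letter it makes the empty word
  non-positive in \<open>weight_pos_iff\<close>. Both are the correct behaviour, and no case distinction remains.
\<close>

definition last_letter :: "letter list \<Rightarrow> letter" where
  "last_letter u = last (Inv 0 # u)"

lemma balance_Nil [simp]: "balance [] = 0"
  by (simp add: balance_def pos_neg_count_def neg_pos_count_def)

lemma last_letter_Nil [simp]: "last_letter [] = Inv 0"
  by (simp add: last_letter_def)

lemma last_letter_snoc [simp]: "last_letter (u @ [y]) = y"
  by (simp add: last_letter_def)

lemma balance_snoc: "balance (u @ [y]) = balance u + turn (last_letter u) y"
proof (cases "u = []")
  case True
  then show ?thesis
    by (cases y) (simp_all add: balance_def pos_neg_count_def neg_pos_count_def)
next
  case False
  have "pos_neg_count (u @ [y]) =
      pos_neg_count u + of_bool (\<exists>i j. j > i \<and> last u = Gen j \<and> y = Inv i)"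
    using card_adjacent_snoc[of u y "\<lambda>a b. \<exists>i j. j > i \<and> a = Gen j \<and> b = Inv i"] False
    by (simp add: pos_neg_count_def)
  moreover have "neg_pos_count (u @ [y]) =
      neg_pos_count u + of_bool (\<exists>i j. j > i \<and> last u = Inv j \<and> y = Gen i)"
    using card_adjacent_snoc[of u y "\<lambda>a b. \<exists>i j. j > i \<and> a = Inv j \<and> b = Gen i"] False
    by (simp add: neg_pos_count_def)
  ultimately show ?thesis
    using False by (cases "last u"; cases y) (auto simp: balance_def last_letter_def)
qed

fun is_gen :: "letter \<Rightarrow> bool" where
  "is_gen (Gen _) = True"
| "is_gen (Inv _) = False"

lemma weight_pos_iff:
  "weight u > 0 \<longleftrightarrow> (if balance u = 0 then is_gen (last_letter u) else balance u > 0)"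
proof -
  have w: "weight u = of_int (balance u) + of_int (last_sign u) / 2"
    by (simp add: weight_def balance_def)
  have s: "\<bar>last_sign u\<bar> \<le> 1" "last_sign u > 0 \<longleftrightarrow> is_gen (last_letter u)"
    by (auto simp: last_sign_def last_letter_def split: letter.split)
  have "weight u > 0 \<longleftrightarrow> (of_int (2 * balance u + last_sign u) :: rat) > 0"
    by (simp add: w field_simps)
  also have "\<dots> \<longleftrightarrow> 2 * balance u + last_sign u > 0"
    by (rule of_int_0_less_iff)
  also have "\<dots> \<longleftrightarrow> (if balance u = 0 then is_gen (last_letter u) else balance u > 0)"
    using s by (auto simp flip: s(2))
  finally show ?thesis .
qed

text \<open>
  In \<open>Scan x b\<close> the letter \<open>x\<close> is the one read last, and \<open>b\<close> tells whether the balance is positive,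
  provided that it is nonzero.
\<close>

datatype control = Start | Scan letter bool | Accept | Reject

instance letter :: countable by countable_datatype
instance control :: countable by countable_datatype

definition move_by :: "int \<Rightarrow> move" where
  "move_by d = (if d > 0 then MoveRight else if d < 0 then MoveLeft else Stay)"

lemma offset_move_by_turn [simp]: "offset (move_by (turn x y)) = turn x y"
  by (cases "(x, y)" rule: turn.cases) (auto simp: move_by_def)

text \<open>
  \<open>Aux 0\<close> is the mark at the origin of the second tape.
\<close>

fun control_step ::
  "control \<Rightarrow> letter symbol \<Rightarrow> letter symbol \<Rightarrow> control \<times> (letter symbol \<times> move) list"
where
  "control_step Start s m = (Scan (Inv 0) False, [(s, Stay), (Aux 0, Stay)])"
| "control_step (Scan x b) (Letter y) m =
     (Scan y (if m = Aux 0 then turn x y > 0 else b), [(Letter y, MoveRight), (m, move_by (turn x y))])"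
| "control_step (Scan x b) s m =
     (if (if m = Aux 0 then is_gen x else b) then Accept else Reject, [(s, Stay), (m, Stay)])"
| "control_step q s m = (q, [(s, Stay), (m, Stay)])"

definition weight_machine :: "nat \<Rightarrow> letter machine" where
  "weight_machine k =
     \<lparr>tapes = 2,
      states = to_nat ` ({Start, Accept, Reject} \<union>
        (\<lambda>(x, b). Scan x b) ` (insert (Inv 0) (letters k) \<times> UNIV)),
      alphabet = {Blank, Aux 0} \<union> Letter ` letters k,
      start_state = to_nat Start,
      accept_state = to_nat Accept,
      reject_state = to_nat Reject,
      transition = (\<lambda>q ss. map_prod to_nat id (control_step (from_nat q) (ss ! 0) (ss ! 1)))\<rparr>"

lemma multitape_TM_weight_machine: "multitape_TM (letters k) (weight_machine k)"
proof -
  have "finite (letters k)" by (simp add: letters_def)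
  moreover have "case transition (weight_machine k) q ss of (q', acts) \<Rightarrow>
      q' \<in> states (weight_machine k) \<and> length acts = tapes (weight_machine k) \<and>
      fst ` set acts \<subseteq> alphabet (weight_machine k)"
    if q: "q \<in> states (weight_machine k)" and len: "length ss = tapes (weight_machine k)"
      and ss: "set ss \<subseteq> alphabet (weight_machine k)" for q ss
  proof -
    from len obtain s m where [simp]: "ss = [s, m]"
      by (auto simp: weight_machine_def length_Suc_conv numeral_2_eq_2)
    from q obtain c where [simp]: "q = to_nat c"
      and "c \<in> {Start, Accept, Reject} \<union>
        (\<lambda>(x, b). Scan x b) ` (insert (Inv 0) (letters k) \<times> UNIV)"
      by (auto simp: weight_machine_def)
    with ss show ?thesis
      by (cases "(c, s, m)" rule: control_step.cases) (auto simp: weight_machine_def)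
  qed
  ultimately show ?thesis
    by (auto simp: multitape_TM_def weight_machine_def)
qed

definition scan_config :: "letter list \<Rightarrow> nat \<Rightarrow> bool \<Rightarrow> letter config" where
  "scan_config u n b =
     (to_nat (Scan (last_letter (take n u)) b),
      [(fst (input_tape u), int n), ((\<lambda>_. Blank)(0 := Aux 0), balance (take n u))])"

lemma step_start: "step (weight_machine k) (initial_config (weight_machine k) u) = scan_config u 0 False"
  by (simp add: initial_config_def weight_machine_def scan_config_def input_tape_def
      blank_tape_def fun_upd_idem)

lemma step_scan:
  assumes "n < length u"
  shows "step (weight_machine k) (scan_config u n b) =
    scan_config u (Suc n)
      (if balance (take n u) = 0 then turn (last_letter (take n u)) (u ! n) > 0 else b)"
  using assms
  by (simp add: scan_config_def weight_machine_def input_tape_def take_Suc_conv_app_nth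
      balance_snoc fun_upd_idem)

lemma step_verdict:
  "fst (step (weight_machine k) (scan_config u (length u) b)) =
    to_nat (if (if balance u = 0 then is_gen (last_letter u) else b) then Accept else Reject)"
  by (simp add: scan_config_def weight_machine_def input_tape_def)

text \<open>
  The bit is meaningless while the balance is \<open>0\<close>, and the invariant leaves it open there: two
  consecutive balances that are both nonzero have the same sign, since they differ by at most \<open>1\<close>.
\<close>

lemma run_scan:
  assumes "n \<le> length u"
  shows "\<exists>b. (step (weight_machine k) ^^ Suc n) (initial_config (weight_machine k) u) =
      scan_config u n b \<and> (balance (take n u) \<noteq> 0 \<longrightarrow> b = (balance (take n u) > 0))"
  using assms
proof (induction n)
  case 0
  then show ?case by (auto simp: step_start)
next
  case (Suc n)
  let ?d = "turn (last_letter (take n u)) (u ! n)"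
  from Suc obtain b
    where run: "(step (weight_machine k) ^^ Suc n) (initial_config (weight_machine k) u) =
      scan_config u n b"
      and b: "balance (take n u) \<noteq> 0 \<longrightarrow> b = (balance (take n u) > 0)"
    by auto
  have bal: "balance (take (Suc n) u) = balance (take n u) + ?d"
    using Suc.prems by (simp add: take_Suc_conv_app_nth balance_snoc)
  have d: "\<bar>?d\<bar> \<le> 1"
    by (cases "(last_letter (take n u), u ! n)" rule: turn.cases) auto
  have "(step (weight_machine k) ^^ Suc (Suc n)) (initial_config (weight_machine k) u) =
      scan_config u (Suc n) (if balance (take n u) = 0 then ?d > 0 else b)"
    using Suc.prems run step_scan by simp
  moreover have "balance (take (Suc n) u) \<noteq> 0 \<longrightarrow>
      (if balance (take n u) = 0 then ?d > 0 else b) = (balance (take (Suc n) u) > 0)"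
    using b d unfolding bal by auto
  ultimately show ?case by blast
qed

lemma run_verdict:
  "fst ((step (weight_machine k) ^^ (length u + 2)) (initial_config (weight_machine k) u)) =
    (if weight u > 0 then accept_state (weight_machine k) else reject_state (weight_machine k))"
proof -
  obtain b
    where "(step (weight_machine k) ^^ Suc (length u)) (initial_config (weight_machine k) u) =
      scan_config u (length u) b"
      and "balance u \<noteq> 0 \<longrightarrow> b = (balance u > 0)"
    using run_scan[of "length u" u k] by auto
  then show ?thesis
    using step_verdict[of k u b] by (simp add: weight_pos_iff weight_machine_def)
qed

theorem mainTheorem2:
  fixes k :: nat
  assumes "k \<ge> 2"
  shows "\<exists>(M :: letter machine) T.
           multitape_TM (letters k) M \<and>
           decides_in_time M (free_group k) (pos_cone k) T \<and>
           (\<lambda>n. real (T n)) \<in> O(\<lambda>n. real n)"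
proof (intro exI conjI)
  show "multitape_TM (letters k) (weight_machine k)"
    by (rule multitape_TM_weight_machine)
  show "decides_in_time (weight_machine k) (free_group k) (pos_cone k) (\<lambda>n. n + 2)"
    unfolding decides_in_time_def
  proof (intro ballI exI conjI)
    fix u assume "u \<in> free_group k"
    then show "fst ((step (weight_machine k) ^^ (length u + 2)) (initial_config (weight_machine k) u)) =
        (if u \<in> pos_cone k then accept_state (weight_machine k)
         else reject_state (weight_machine k))"
      using run_verdict by (simp add: pos_cone_def)
  qed simp
  show "(\<lambda>n. real (n + 2)) \<in> O(\<lambda>n. real n)"
    by (rule bigoI[of _ 3]) (auto intro!: eventually_at_top_linorderI[of 1])
qed

end
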